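(* For every $2\leq K<3$ and every $\varepsilon>0$, there exist an exact sequence \[ 0\to\mathbb{T}\xrightarrow{\ell}\mathbb{T}^2\xrightarrow{\pi}\mathbb{T}\to 0 \] with $\ell(t)=(0,t)$ and $\pi(x,y)=x$, and a compact set $A\subseteq\mathbb{T}^2$ such that $0<\mu_{\mathbb{T}^2}(A)=\mu_{\mathbb{T}}(\pi(A))<\varepsilon$, $\mu_{\mathbb{T}^2}(A+A)=K\mu_{\mathbb{T}^2}(A)$, and \[ \mu_{\mathbb{T}}(\pi(A)+\pi(A))=(2K-2)\mu_{\mathbb{T}}(\pi(A))=2\bigl(\mu_{\mathbb{T}^2}(A+A)-\mu_{\mathbb{T}^2}(A)\bigr). \]
   Context: $\mathbb{T}=\mathbb{R}/\mathbb{Z}$; $\mu_{\mathbb{T}}$ and $\mu_{\mathbb{T}^2}$ denote the normalized Haar (Lebesgue) measures. $X+Y=\{x+y:x\in X,\,y\in Y\}$. *)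

theory Defs
  imports "HOL-Analysis.Analysis"
begin

quotient_type circle = real / "\<lambda>x y. x - y \<in> \<int>"
  morphisms rep_circle to_circle
proof (rule equivpI)
  show "reflp (\<lambda>x y::real. x - y \<in> \<int>)" by (auto intro!: reflpI)
  show "symp (\<lambda>x y::real. x - y \<in> \<int>)"
    by (rule sympI) (subst minus_diff_eq[symmetric], rule Ints_minus)
  show "transp (\<lambda>x y::real. x - y \<in> \<int>)"
  proof (rule transpI)
    fix x y z :: real assume "x - y \<in> \<int>" "y - z \<in> \<int>"
    from Ints_add[OF this] show "x - z \<in> \<int>" by simp
  qed
qed

lemma to_circle_eq_iff: "to_circle x = to_circle y \<longleftrightarrow> x - y \<in> \<int>"
  by (rule circle.abs_eq_iff)

instantiation circle :: ab_group_add
begin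

lift_definition zero_circle :: circle is 0 .

lift_definition plus_circle :: "circle \<Rightarrow> circle \<Rightarrow> circle" is "(+)"
  by (simp only: add_diff_add Ints_add)

lift_definition uminus_circle :: "circle \<Rightarrow> circle" is uminus
  by (simp only: minus_diff_minus Ints_minus)

lift_definition minus_circle :: "circle \<Rightarrow> circle \<Rightarrow> circle" is "(-)"
proof -
  fix a b c d :: real assume "a - b \<in> \<int>" "c - d \<in> \<int>"
  from Ints_diff[OF this] show "(a - c) - (b - d) \<in> \<int>" by (simp add: algebra_simps)
qed

instance
  by standard (transfer; simp)+

end

lemma to_circle_add: "to_circle (x + y) = to_circle x + to_circle y"
  by (simp add: plus_circle.abs_eq)

instantiation circle :: topological_space
begin

definition open_circle :: "circle set \<Rightarrow> bool"
  where "open_circle U \<longleftrightarrow> open (to_circle -` U)"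

instance
  by standard (auto simp: open_circle_def vimage_Union)

end

lemma continuous_to_circle: "continuous_on UNIV to_circle"
  by (auto simp: continuous_on_open_vimage open_circle_def)

lemma open_map_to_circle:
  assumes "open U"
  shows "open (to_circle ` U)"
proof -
  have "to_circle -` (to_circle ` U) = (\<Union>k\<in>\<int>. (\<lambda>x. k + x) ` U)"
  proof (intro equalityI subsetI)
    fix x assume "x \<in> to_circle -` (to_circle ` U)"
    then obtain u where u: "u \<in> U" "x - u \<in> \<int>" by (auto simp: to_circle_eq_iff)
    then have "x = (x - u) + u" by simp
    with u show "x \<in> (\<Union>k\<in>\<int>. (\<lambda>x. k + x) ` U)" by blast
  next
    fix x assume "x \<in> (\<Union>k\<in>\<int>. (\<lambda>x. k + x) ` U)"
    then obtain k u where "k \<in> \<int>" "u \<in> U" "x = k + u" by blast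
    then show "x \<in> to_circle -` (to_circle ` U)"
      by (auto simp: to_circle_eq_iff intro!: image_eqI[where x = u])
  qed
  then show ?thesis
    using assms by (auto simp: open_circle_def intro!: open_UN open_translation)
qed

lemma nhds_to_circle: "nhds (to_circle x) = filtermap to_circle (nhds x)"
  using filtermap_nhds_open_map[of x to_circle] continuous_to_circle open_map_to_circle
  by (simp add: continuous_on_eq_continuous_at)

lemma to_circle_surj: "\<exists>r. x = to_circle r"
  using Quotient3_abs_rep[OF Quotient3_circle, of x] by (intro exI[of _ "rep_circle x"]) simp

lemma tendsto_to_circle: "filterlim to_circle (nhds (to_circle x)) (nhds x)"
  by (simp add: nhds_to_circle filterlim_def)

lemma cis_2pi_eq_iff: "cis (2 * pi * x) = cis (2 * pi * y) \<longleftrightarrow> x - y \<in> \<int>"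
proof -
  have "cis (2 * pi * x) = cis (2 * pi * y) \<longleftrightarrow>
      (\<exists>n::int. 2 * pi * x = 2 * pi * y + 2 * pi * of_int n)"
    using sin_cos_eq_iff[of "2 * pi * x" "2 * pi * y"]
    by (simp only: complex_eq_iff cis.sel conj_commute)
  also have "\<dots> \<longleftrightarrow> (\<exists>n::int. x = y + of_int n)"
  proof (rule arg_cong[where f = Ex], rule ext)
    fix n :: int
    have "2 * pi * y + 2 * pi * of_int n = 2 * pi * (y + of_int n)"
      by (simp add: distrib_left)
    then show "(2 * pi * x = 2 * pi * y + 2 * pi * of_int n) = (x = y + of_int n)"
      by simp
  qed
  also have "\<dots> \<longleftrightarrow> x - y \<in> \<int>"
    by (auto simp: Ints_def algebra_simps)
  finally show ?thesis .
qed

lift_definition circle_cis :: "circle \<Rightarrow> complex" is "\<lambda>x. cis (2 * pi * x)"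
  by (simp add: cis_2pi_eq_iff)

instance circle :: t2_space
proof
  fix x y :: circle assume "x \<noteq> y"
  then have ne: "circle_cis x \<noteq> circle_cis y"
    by transfer (simp add: cis_2pi_eq_iff)
  have op: "open (circle_cis -` V)" if "open V" for V
  proof -
    have "to_circle -` circle_cis -` V = (\<lambda>r. cis (2 * pi * r)) -` V"
      by (auto simp: circle_cis.abs_eq)
    moreover have "continuous_on UNIV (\<lambda>r::real. cis (2 * pi * r))"
      by (intro continuous_intros)
    ultimately show ?thesis
      using that by (simp add: open_circle_def continuous_on_open_vimage)
  qed
  obtain U V where "open U" "open V" "circle_cis x \<in> U" "circle_cis y \<in> V" "U \<inter> V = {}"
    using hausdorff[OF ne] by blast
  then show "\<exists>U V. open U \<and> open V \<and> x \<in> U \<and> y \<in> V \<and> U \<inter> V = {}"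
    by (intro exI[of _ "circle_cis -` U"] exI[of _ "circle_cis -` V"]) (auto intro: op)
qed

instance circle :: second_countable_topology
proof
  obtain B :: "real set set" where B: "countable B" "topological_basis B"
    using ex_countable_basis by blast
  have "topological_basis ((`) to_circle ` B)"
  proof (rule topological_basisI)
    fix U assume "U \<in> (`) to_circle ` B"
    then show "open U" using B(2) by (auto intro: open_map_to_circle topological_basis_open)
  next
    fix U :: "circle set" and x assume U: "open U" "x \<in> U"
    obtain r where r: "x = to_circle r" using to_circle_surj by blast
    with U obtain V where "V \<in> B" "r \<in> V" "V \<subseteq> to_circle -` U"
      using topological_basisE[OF B(2), of "to_circle -` U" r] by (auto simp: open_circle_def)
    then show "\<exists>W\<in>(`) to_circle ` B. x \<in> W \<and> W \<subseteq> U" using r by blast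
  qed
  then have "open = generate_topology ((`) to_circle ` B)"
    by (rule topological_basis_imp_subbasis)
  then show "\<exists>B::circle set set. countable B \<and> open = generate_topology B"
    using B(1) by blast
qed

instance circle :: topological_ab_group_add
proof
  fix a b :: circle
  obtain r s where rs: "a = to_circle r" "b = to_circle s"
    using to_circle_surj by blast
  have "((\<lambda>x. to_circle (fst x + snd x)) \<longlongrightarrow> to_circle (r + s)) (nhds r \<times>\<^sub>F nhds s)"
    by (rule filterlim_compose[OF tendsto_to_circle tendsto_add_Pair])
  then show "((\<lambda>x. fst x + snd x) \<longlongrightarrow> a + b) (nhds a \<times>\<^sub>F nhds b)"
    by (simp add: rs nhds_to_circle[of r] nhds_to_circle[of s] prod_filtermap1 prod_filtermap2
        filterlim_filtermap to_circle_add)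
  have "((\<lambda>x. to_circle (- x)) \<longlongrightarrow> to_circle (- r)) (nhds r)"
    by (rule filterlim_compose[OF tendsto_to_circle tendsto_uminus_nhds])
  then show "(uminus \<longlongrightarrow> - a) (nhds a)"
    by (simp add: rs nhds_to_circle[of r] filterlim_filtermap uminus_circle.abs_eq)
qed

lemma compact_UNIV_circle: "compact (UNIV :: circle set)"
proof -
  have "x \<in> to_circle ` {0..1}" for x
  proof -
    obtain r where "x = to_circle r" using to_circle_surj by blast
    also have "\<dots> = to_circle (frac r)" by (simp add: to_circle_eq_iff frac_def)
    finally show ?thesis by (rule image_eqI) (simp add: less_imp_le[OF frac_lt_1])
  qed
  then have "UNIV = to_circle ` {0..1}" by (intro set_eqI) simp
  moreover have "compact (to_circle ` {0..1})"
    by (rule compact_continuous_image[OF continuous_on_subset[OF continuous_to_circle]]) simp_all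
  ultimately show ?thesis by simp
qed

text \<open>On Borel sets this is the normalized Haar measure, being translation invariant of total
  mass 1.\<close>

definition circle_haar :: "circle measure"
  where "circle_haar = distr (restrict_space lborel {0..<1}) borel to_circle"

definition torus_haar :: "(circle \<times> circle) measure"
  where "torus_haar = circle_haar \<Otimes>\<^sub>M circle_haar"

lemma sets_circle_haar: "sets circle_haar = sets borel"
  by (simp add: circle_haar_def)

lemma sets_torus_haar: "sets torus_haar = sets borel"
  unfolding torus_haar_def borel_prod[symmetric]
  by (intro sets_pair_measure_cong sets_circle_haar)

lemma measurable_to_circle: "to_circle \<in> borel_measurable borel"
  by (rule borel_measurable_continuous_onI[OF continuous_to_circle])

lemma emeasure_circle_haar:
  assumes "B \<in> sets borel"
  shows "emeasure circle_haar B = emeasure lborel (to_circle -` B \<inter> {0..<1})"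
  using assms measurable_sets_borel[OF measurable_to_circle assms]
  by (simp add: circle_haar_def emeasure_distr measurable_restrict_space1 measurable_to_circle
      space_restrict_space emeasure_restrict_space)

lemma emeasure_circle_haar_UNIV: "emeasure circle_haar UNIV = 1"
  by (simp add: emeasure_circle_haar)

lemma emeasure_torus_haar_UNIV: "emeasure torus_haar UNIV = 1"
proof -
  have "space circle_haar = UNIV" by (simp add: circle_haar_def)
  then interpret finite_measure circle_haar
    by (intro finite_measureI) (simp add: emeasure_circle_haar_UNIV)
  show ?thesis
    using emeasure_pair_measure_Times[of UNIV circle_haar UNIV]
    by (simp add: torus_haar_def sets_circle_haar emeasure_circle_haar_UNIV)
qed

lemma circle_haar_translation: "distr circle_haar borel ((+) a) = circle_haar"
proof (rule measure_eqI)
  show "sets (distr circle_haar borel ((+) a)) = sets circle_haar"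
    by (simp add: sets_circle_haar)
next
  fix B assume "B \<in> sets (distr circle_haar borel ((+) a))"
  then have B: "B \<in> sets borel" by simp
  obtain r0 where "a = to_circle r0" using to_circle_surj by blast
  also have "\<dots> = to_circle (frac r0)" by (simp add: to_circle_eq_iff frac_def)
  finally have a0: "a = to_circle (frac r0)" .
  define r where "r = frac r0"
  have a: "a = to_circle r" and r: "0 \<le> r" "r < 1"
    using a0 by (simp_all add: r_def frac_lt_1)
  define P where "P = to_circle -` B"
  have P: "P \<in> sets borel"
    unfolding P_def by (rule measurable_sets_borel[OF measurable_to_circle B])
  have P1: "1 + x \<in> P \<longleftrightarrow> x \<in> P" for x
  proof -
    have "to_circle (1 + x) = to_circle x" by (simp add: to_circle_eq_iff)
    then show ?thesis by (simp add: P_def)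
  qed
  have shift: "emeasure lborel ((+) c -` S) = emeasure lborel S" if "S \<in> sets borel" for S and c :: real
    using that emeasure_distr[of "(+) c" lborel borel S] by (simp add: lborel_distr_plus)
  have m: "(+) a \<in> borel_measurable circle_haar"
    by (subst measurable_cong_sets[OF sets_circle_haar refl])
      (intro borel_measurable_continuous_onI continuous_on_add continuous_on_const continuous_on_id)
  have "emeasure (distr circle_haar borel ((+) a)) B = emeasure circle_haar ((+) a -` B)"
    using m B by (simp add: emeasure_distr circle_haar_def)
  also have "\<dots> = emeasure lborel (to_circle -` ((+) a -` B) \<inter> {0..<1})"
    using measurable_sets[OF m B] by (intro emeasure_circle_haar) (simp add: circle_haar_def)
  also have "to_circle -` ((+) a -` B) \<inter> {0..<1} = (+) r -` (P \<inter> {r..<1 + r})"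
    by (auto simp: a P_def to_circle_add)
  also have "emeasure lborel \<dots> = emeasure lborel (P \<inter> {r..<1 + r})"
    using P by (intro shift) auto
  also have "P \<inter> {r..<1 + r} = (P \<inter> {r..<1}) \<union> (P \<inter> {1..<1 + r})"
    using r by auto
  also have "emeasure lborel \<dots> = emeasure lborel (P \<inter> {r..<1}) + emeasure lborel (P \<inter> {1..<1 + r})"
    using P by (intro plus_emeasure[symmetric]) auto
  also have "emeasure lborel (P \<inter> {1..<1 + r}) = emeasure lborel ((+) 1 -` (P \<inter> {1..<1 + r}))"
    using P by (intro shift[symmetric]) auto
  also have "(+) 1 -` (P \<inter> {1..<1 + r}) = P \<inter> {0..<r}"
    by (auto simp: P1)
  also have "emeasure lborel (P \<inter> {r..<1}) + emeasure lborel (P \<inter> {0..<r}) =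
      emeasure lborel ((P \<inter> {r..<1}) \<union> (P \<inter> {0..<r}))"
    using P by (intro plus_emeasure) auto
  also have "(P \<inter> {r..<1}) \<union> (P \<inter> {0..<r}) = to_circle -` B \<inter> {0..<1}"
    using r by (auto simp: P_def)
  also have "emeasure lborel \<dots> = emeasure circle_haar B"
    using B by (simp add: emeasure_circle_haar)
  finally show "emeasure (distr circle_haar borel ((+) a)) B = emeasure circle_haar B" .
qed

text \<open>Exactness of \<open>0 \<rightarrow> 'a \<rightarrow> 'b \<rightarrow> 'c \<rightarrow> 0\<close> in the category of topological abelian groups
  with continuous homomorphisms. For compact Hausdorff groups \<open>l\<close> is then automatically a closed
  embedding and \<open>p\<close> an open map.\<close>

definition short_exact ::
    "('a::{topological_space,ab_group_add} \<Rightarrow> 'b::{topological_space,ab_group_add}) \<Rightarrow>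
     ('b \<Rightarrow> 'c::{topological_space,ab_group_add}) \<Rightarrow> bool"
  where "short_exact l p \<longleftrightarrow>
    continuous_on UNIV l \<and> (\<forall>x y. l (x + y) = l x + l y) \<and>
    continuous_on UNIV p \<and> (\<forall>x y. p (x + y) = p x + p y) \<and>
    inj l \<and> range l = {x. p x = 0} \<and> surj p"

end

theory Submission
  imports Defs
begin

text \<open>
  The set \<open>A\<close> is a vertical strip together with a null set whose sumset is large. Since
  \<open>\<mu>(A) = \<mu>(\<pi>(A))\<close> forces almost every nonempty fibre of \<open>A\<close> to have full measure, the
  freedom that matters lies over a null subset of \<open>\<pi>(A)\<close>. The Cantor set \<open>C \<subseteq> [0,1]\<close> is null, yet
  \<open>C + C = [0,2]\<close> (\<open>negligible_cantor_set\<close>, \<open>cantor_set_plus_cantor_set\<close>).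
  Let \<open>a > 0\<close> be small, put \<open>s = (K - 1) a \<in> [a, 2a)\<close> and
  \<open>A = [0,a] \<times> T \<union> sC \<times> {0}\<close>, where \<open>T\<close> is the circle.
  Both \<open>A\<close> and \<open>\<pi>(A)\<close> have measure \<open>a\<close>. In \<open>A + A\<close> the full fibres lie over
  \<open>[0,2a] \<union> ([0,a] + sC) = [0, a + s] = [0, Ka]\<close>: the set \<open>sC\<close> lies in \<open>[0,s]\<close>, it contains \<open>s\<close>,
  and \<open>s \<le> 2a\<close>. The remaining part \<open>[0,2s] \<times> {0}\<close> of \<open>A + A\<close> is null in the torus, but its
  projection is not, so that \<open>\<mu>(A + A) = Ka\<close> while \<open>\<mu>(\<pi>(A) + \<pi>(A)) = 2s = (2K - 2) a\<close>;
  see \<open>strip_Un_horizontal_plus_self\<close> and \<open>measure_torus_haar_strip_Un_horizontal\<close>.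
  The smallness of \<open>a\<close> keeps every interval that occurs inside \<open>[0,1)\<close>, where passing to the circle
  preserves lengths.
\<close>

section \<open>The Cantor set and its sumset\<close>

text \<open>
  The two contractions are written in the shape \<open>m x + c\<close> to which the scaling of Lebesgue measure
  under affine maps applies.
\<close>

primrec cantor_stage :: "nat \<Rightarrow> real set" where
  "cantor_stage 0 = {0..1}"
| "cantor_stage (Suc n) =
     (\<lambda>x. (1/3) *\<^sub>R x + 0) ` cantor_stage n \<union> (\<lambda>x. (1/3) *\<^sub>R x + 2/3) ` cantor_stage n"

definition cantor_set :: "real set" where
  "cantor_set = (\<Inter>n. cantor_stage n)"

lemma compact_cantor_stage: "compact (cantor_stage n)"
proof (induction n)
  case (Suc n)
  then show ?case
    by (auto intro!: compact_Un compact_continuous_image continuous_intros)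
qed simp

lemma cantor_stage_Suc_subset: "cantor_stage (Suc n) \<subseteq> cantor_stage n"
proof (induction n)
  case 0
  show ?case by auto
next
  case (Suc n)
  then show ?case
    unfolding cantor_stage.simps(2)[of "Suc n"] cantor_stage.simps(2)[of n]
    by (intro Un_mono image_mono) auto
qed

lemma decseq_cantor_stage: "decseq cantor_stage"
  by (intro decseq_SucI cantor_stage_Suc_subset)

lemma cantor_set_subset: "cantor_set \<subseteq> {0..1}"
  unfolding cantor_set_def using cantor_stage.simps(1) by blast

lemma compact_cantor_set: "compact cantor_set"
proof -
  have "closed cantor_set"
    unfolding cantor_set_def by (intro closed_INT ballI compact_imp_closed compact_cantor_stage)
  then have "compact ({0..1} \<inter> cantor_set)"
    by (intro compact_Int_closed) auto
  then show ?thesis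
    using cantor_set_subset by (simp add: Int_absorb1)
qed

lemma measure_cantor_stage_le: "measure lebesgue (cantor_stage n) \<le> (2/3) ^ n"
proof (induction n)
  case (Suc n)
  have lm: "S \<in> lmeasurable" if "compact S" for S :: "real set"
    using that by (rule lmeasurable_compact)
  have "measure lebesgue (cantor_stage (Suc n))
      \<le> measure lebesgue ((\<lambda>x. (1/3) *\<^sub>R x + 0) ` cantor_stage n)
        + measure lebesgue ((\<lambda>x. (1/3) *\<^sub>R x + 2/3) ` cantor_stage n)"
    unfolding cantor_stage.simps
    by (intro measure_Un_le fmeasurableD lm compact_continuous_image compact_cantor_stage
        continuous_intros)
  also have "\<dots> = 2/3 * measure lebesgue (cantor_stage n)"
    unfolding measure_lebesgue_affine by simp
  also have "\<dots> \<le> (2/3) ^ Suc n"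
    using Suc by simp
  finally show ?case .
qed simp

lemma negligible_cantor_set: "negligible cantor_set"
proof -
  have "measure lebesgue cantor_set \<le> (2/3) ^ n" for n
  proof -
    have "measure lebesgue cantor_set \<le> measure lebesgue (cantor_stage n)"
      by (intro measure_mono_fmeasurable lmeasurable_compact fmeasurableD compact_cantor_stage
          compact_cantor_set) (auto simp: cantor_set_def)
    then show ?thesis using measure_cantor_stage_le[of n] by linarith
  qed
  moreover have "(\<lambda>n. (2/3::real) ^ n) \<longlonglongrightarrow> 0"
    by (intro LIMSEQ_power_zero) simp
  ultimately have "measure lebesgue cantor_set \<le> 0"
    by (intro LIMSEQ_le_const[of _ 0]) auto
  then show ?thesis
    using lmeasurable_compact[OF compact_cantor_set] measure_nonneg[of lebesgue cantor_set]
    by (simp add: negligible_iff_measure)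
qed

text \<open>
  Each stage already has full sumset: the sumset of the next stage consists of the translates of
  \<open>[0,2/3]\<close> by \<open>0\<close>, \<open>2/3\<close> and \<open>4/3\<close>, which tile \<open>[0,2]\<close>.
\<close>

lemma cantor_stage_sum:
  "z \<in> {0..2} \<Longrightarrow> \<exists>x\<in>cantor_stage n. z - x \<in> cantor_stage n"
proof (induction n arbitrary: z)
  case 0
  then show ?case by (intro bexI[of _ "z / 2"]) auto
next
  case (Suc n)
  let ?f = "\<lambda>x::real. (1/3) *\<^sub>R x + 0" and ?g = "\<lambda>x::real. (1/3) *\<^sub>R x + 2/3"
  have f: "?f x \<in> cantor_stage (Suc n)" and g: "?g x \<in> cantor_stage (Suc n)"
    if "x \<in> cantor_stage n" for x
    unfolding cantor_stage.simps by (intro UnI1 UnI2 imageI that)+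
  consider "3 * z \<in> {0..2}" | "3 * z - 2 \<in> {0..2}" | "3 * z - 4 \<in> {0..2}"
    using Suc.prems by force
  then show ?case
  proof cases
    case 1
    then obtain x where "x \<in> cantor_stage n" "3 * z - x \<in> cantor_stage n"
      using Suc.IH by blast
    moreover have "z - ?f x = ?f (3 * z - x)" by simp
    ultimately show ?thesis
      using f g by metis
  next
    case 2
    then obtain x where "x \<in> cantor_stage n" "3 * z - 2 - x \<in> cantor_stage n"
      using Suc.IH by blast
    moreover have "z - ?f x = ?g (3 * z - 2 - x)" by (simp add: field_simps)
    ultimately show ?thesis
      using f g by metis
  next
    case 3
    then obtain x where "x \<in> cantor_stage n" "3 * z - 4 - x \<in> cantor_stage n"
      using Suc.IH by blast
    moreover have "z - ?g x = ?g (3 * z - 4 - x)" by (simp add: field_simps)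
    ultimately show ?thesis
      using g by metis
  qed
qed

text \<open>
  Compactness carries the full sumset over to the limit: for fixed \<open>z\<close> the summands \<open>x\<close> that work
  at stage \<open>n\<close> form a decreasing sequence of nonempty compact sets.
\<close>

lemma cantor_set_plus_cantor_set: "cantor_set + cantor_set = {0..2}"
proof
  show "cantor_set + cantor_set \<subseteq> {0..2}"
  proof
    fix z assume "z \<in> cantor_set + cantor_set"
    then obtain x y where "z = x + y" "x \<in> cantor_set" "y \<in> cantor_set"
      by (rule set_plus_elim)
    moreover from this have "x \<in> {0..1}" "y \<in> {0..1}"
      using cantor_set_subset by blast+
    ultimately show "z \<in> {0..2}" by simp
  qed
  show "{0..2} \<subseteq> cantor_set + cantor_set"
  proof
    fix z :: real assume z: "z \<in> {0..2}"
    define F where "F n = cantor_stage n \<inter> (\<lambda>x. z - x) ` cantor_stage n" for n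
    have F_iff: "x \<in> F n \<longleftrightarrow> x \<in> cantor_stage n \<and> z - x \<in> cantor_stage n" for x n
    proof -
      have "x \<in> (\<lambda>x. z - x) ` cantor_stage n \<longleftrightarrow> z - x \<in> cantor_stage n"
        by (force intro: image_eqI[of _ _ "z - x"])
      then show ?thesis by (simp add: F_def)
    qed
    have "\<Inter>(range F) \<noteq> {}"
    proof (rule compact_nest)
      show "compact (F n)" for n
        unfolding F_def
        by (intro compact_Int compact_continuous_image compact_cantor_stage continuous_intros)
      show "F n \<noteq> {}" for n
        using cantor_stage_sum[OF z] F_iff by blast
      show "F n \<subseteq> F m" if "m \<le> n" for m n
        using decseqD[OF decseq_cantor_stage that] F_iff by blast
    qed
    then obtain x where "\<And>n. x \<in> F n" by blast
    then have "x \<in> cantor_set" "z - x \<in> cantor_set"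
      by (auto simp: cantor_set_def F_iff)
    then have "x + (z - x) \<in> cantor_set + cantor_set" by (rule set_plus_intro)
    then show "z \<in> cantor_set + cantor_set" by simp
  qed
qed

lemma one_in_cantor_set: "1 \<in> cantor_set"
proof -
  have "2 \<in> cantor_set + cantor_set"
    by (simp add: cantor_set_plus_cantor_set)
  then obtain x y where "x \<in> cantor_set" "y \<in> cantor_set" "x + y = 2"
    by (auto elim!: set_plus_elim)
  moreover from this have "x \<le> 1" "y \<le> 1"
    using cantor_set_subset by auto
  ultimately have "x \<in> cantor_set" "x = 1" by linarith+
  then show ?thesis by simp
qed

lemma scaled_null_set_with_interval_sumset:
  fixes s :: real
  assumes "0 \<le> s"
  obtains N where "compact N" "N \<subseteq> {0..s}" "s \<in> N" "negligible N" "N + N = {0..2 * s}"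
proof
  let ?N = "(\<lambda>x. s * x) ` cantor_set"
  show "compact ?N"
    by (intro compact_continuous_image continuous_intros compact_cantor_set)
  show "?N \<subseteq> {0..s}"
    using cantor_set_subset assms by (auto simp: mult_left_le)
  show "s \<in> ?N"
    using one_in_cantor_set by force
  show "negligible ?N"
    by (intro negligible_differentiable_image_negligible negligible_cantor_set)
      (auto intro!: derivative_intros)
  have "?N + ?N = (\<lambda>x. s * x) ` (cantor_set + cantor_set)"
  proof
    show "?N + ?N \<subseteq> (\<lambda>x. s * x) ` (cantor_set + cantor_set)"
      by (auto elim!: set_plus_elim simp flip: distrib_left)
    show "(\<lambda>x. s * x) ` (cantor_set + cantor_set) \<subseteq> ?N + ?N"
      by (auto elim!: set_plus_elim simp: distrib_left intro!: set_plus_intro)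
  qed
  also have "\<dots> = {0..2 * s}"
    unfolding cantor_set_plus_cantor_set
    using assms by (simp add: image_mult_atLeastAtMost_if mult.commute[of s 2])
  finally show "?N + ?N = {0..2 * s}" .
qed

section \<open>Measures of sets in the circle and the torus\<close>

lemma compact_to_circle_image: "compact S \<Longrightarrow> compact (to_circle ` S)"
  by (rule compact_continuous_image[OF continuous_on_subset[OF continuous_to_circle]]) auto

lemma to_circle_image_plus: "to_circle ` X + to_circle ` Y = to_circle ` (X + Y)"
proof
  show "to_circle ` X + to_circle ` Y \<subseteq> to_circle ` (X + Y)"
    by (auto elim!: set_plus_elim simp flip: to_circle_add)
  show "to_circle ` (X + Y) \<subseteq> to_circle ` X + to_circle ` Y"
    by (auto elim!: set_plus_elim simp: to_circle_add intro!: set_plus_intro)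
qed

lemma emeasure_circle_haar_image:
  assumes "compact S" "S \<subseteq> {0..<1}"
  shows "emeasure circle_haar (to_circle ` S) = emeasure lborel S"
proof -
  have "to_circle -` (to_circle ` S) \<inter> {0..<1} = S"
  proof (intro equalityI subsetI)
    fix x assume "x \<in> to_circle -` (to_circle ` S) \<inter> {0..<1}"
    then obtain y where y: "y \<in> S" "x - y \<in> \<int>" "0 \<le> x" "x < 1"
      by (auto simp: to_circle_eq_iff)
    then have "\<bar>x - y\<bar> < 1" using assms(2) by force
    then have "x = y" using y(2) Ints_nonzero_abs_less1 by force
    then show "x \<in> S" using y by simp
  qed (use assms(2) in auto)
  moreover have "to_circle ` S \<in> sets borel"
    using compact_to_circle_image[OF assms(1)] by (simp add: borel_compact)
  ultimately show ?thesis by (simp add: emeasure_circle_haar)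
qed

lemma measure_circle_haar_interval:
  assumes "0 \<le> b" "b < 1"
  shows "measure circle_haar (to_circle ` {0..b}) = b"
proof -
  have "emeasure circle_haar (to_circle ` {0..b}) = ennreal b"
    using emeasure_circle_haar_image[of "{0..b}"] assms by force
  then show ?thesis
    using assms by (simp add: measure_def)
qed

lemma null_sets_circle_haar_image:
  assumes "compact S" "S \<subseteq> {0..<1}" "negligible S"
  shows "to_circle ` S \<in> null_sets circle_haar"
proof -
  have "S \<in> sets lborel" using assms(1) by (simp add: borel_compact)
  then have "emeasure lborel S = 0"
    using assms(3) emeasure_completion[of S lborel]
    by (auto simp: negligible_iff_null_sets null_sets_def main_part_sets)
  then show ?thesis
    using assms(1,2)
    by (simp add: null_sets_def emeasure_circle_haar_image sets_circle_haar borel_compact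
        compact_to_circle_image)
qed

lemma sigma_finite_circle_haar: "sigma_finite_measure circle_haar"
proof -
  have "space circle_haar = UNIV" by (simp add: circle_haar_def)
  then interpret finite_measure circle_haar
    by (intro finite_measureI) (simp add: emeasure_circle_haar_UNIV)
  show ?thesis by unfold_locales
qed

text \<open>The part \<open>M \<times> {0}\<close> is null however large \<open>M\<close> is, because a point of the circle is null.\<close>

lemma measure_torus_haar_strip_Un_horizontal:
  assumes "compact B" "compact M"
  shows "measure torus_haar (B \<times> UNIV \<union> M \<times> {0}) = measure circle_haar B"
proof -
  interpret sigma_finite_measure circle_haar by (rule sigma_finite_circle_haar)
  have sets: "B \<in> sets circle_haar" "M \<in> sets circle_haar" "{0} \<in> sets circle_haar"
    "UNIV \<in> sets circle_haar"
    using assms by (auto simp: sets_circle_haar borel_compact)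
  have "(0::circle) = to_circle 0" by (simp add: zero_circle_def)
  then have zero: "emeasure circle_haar {0} = 0"
    using emeasure_circle_haar_image[of "{0}"] by simp
  have "M \<times> {0} \<in> null_sets torus_haar"
    using sets zero by (auto simp: torus_haar_def null_sets_def emeasure_pair_measure_Times)
  moreover have "B \<times> UNIV \<in> sets torus_haar"
    using sets by (auto simp: torus_haar_def)
  ultimately have "emeasure torus_haar (B \<times> UNIV \<union> M \<times> {0}) = emeasure torus_haar (B \<times> UNIV)"
    by (rule emeasure_Un_null_set[rotated])
  also have "\<dots> = emeasure circle_haar B"
    using sets by (simp add: torus_haar_def emeasure_pair_measure_Times emeasure_circle_haar_UNIV)
  finally show ?thesis by (simp add: measure_def)
qed

text \<open>A full fibre absorbs any nonempty fibre added to it, so every sum that involves \<open>B\<close> has full fibres.\<close>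

lemma strip_Un_horizontal_plus_self:
  fixes B M :: "circle set"
  assumes "B \<noteq> {}"
  shows "(B \<times> UNIV \<union> M \<times> {0}) + (B \<times> UNIV \<union> M \<times> {0})
    = (B + (B \<union> M)) \<times> (UNIV :: circle set) \<union> (M + M) \<times> {0}" (is "?A + ?A = ?R")
proof
  show "?A + ?A \<subseteq> ?R"
  proof
    fix u assume "u \<in> ?A + ?A"
    then obtain x t y t' where u: "u = (x + y, t + t')" "(x, t) \<in> ?A" "(y, t') \<in> ?A"
      by (elim set_plus_elim) (metis add_Pair prod.collapse)
    then consider "x \<in> B" "y \<in> B \<union> M" | "y \<in> B" "x \<in> B \<union> M"
      | "x \<in> M" "y \<in> M" "t = 0" "t' = 0"
      by auto
    then show "u \<in> ?R"
    proof cases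
      case 1
      then show ?thesis using u(1) by auto
    next
      case 2
      then have "y + x \<in> B + (B \<union> M)" by (rule set_plus_intro)
      then show ?thesis using u(1) by (simp add: add.commute)
    next
      case 3
      then show ?thesis using u(1) by auto
    qed
  qed
  show "?R \<subseteq> ?A + ?A"
  proof
    fix u assume "u \<in> ?R"
    then consider x y t where "u = (x + y, t)" "x \<in> B" "y \<in> B \<union> M"
      | x y where "u = (x + y, 0)" "x \<in> M" "y \<in> M"
      by (elim UnE SigmaE set_plus_elim) auto
    then show "u \<in> ?A + ?A"
    proof cases
      case 1
      then have "(x, t) \<in> ?A" "(y, 0) \<in> ?A" "u = (x, t) + (y, 0)" by auto
      then show ?thesis by (metis set_plus_intro)
    next
      case 2
      then have "(x, 0) \<in> ?A" "(y, 0) \<in> ?A" "u = (x, 0) + (y, 0)" by auto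
      then show ?thesis by (metis set_plus_intro)
    qed
  qed
qed

lemma short_exact_coordinates:
  "short_exact (\<lambda>t::circle. (0::circle, t)) (fst :: circle \<times> circle \<Rightarrow> circle)"
  unfolding short_exact_def
proof (intro conjI)
  show "range (\<lambda>t::circle. (0::circle, t)) = {x. fst x = 0}" by force
  show "surj (fst :: circle \<times> circle \<Rightarrow> circle)" by (rule surjI[of _ "\<lambda>x. (x, 0)"]) simp
qed (simp_all add: inj_def continuous_on_Pair continuous_on_const continuous_on_id
    continuous_on_fst)

section \<open>The example\<close>

theorem proposition5p2:
  fixes K \<epsilon> :: real
  assumes "2 \<le> K" and "K < 3" and "\<epsilon> > 0"
  shows "\<exists>(l :: circle \<Rightarrow> circle \<times> circle) (p :: circle \<times> circle \<Rightarrow> circle) (A :: (circle \<times> circle) set).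
    short_exact l p \<and> (\<forall>t. l t = (0, t)) \<and> (\<forall>x y. p (x, y) = x) \<and>
    compact A \<and>
    0 < measure torus_haar A \<and>
    measure torus_haar A = measure circle_haar (p ` A) \<and>
    measure circle_haar (p ` A) < \<epsilon> \<and>
    measure torus_haar (A + A) = K * measure torus_haar A \<and>
    measure circle_haar (p ` A + p ` A) = (2 * K - 2) * measure circle_haar (p ` A) \<and>
    (2 * K - 2) * measure circle_haar (p ` A) = 2 * (measure torus_haar (A + A) - measure torus_haar A)"
proof -
  \<comment> \<open>The longest interval that occurs is \<open>[0, (2K - 2) a]\<close>, and \<open>2K - 2 < 4\<close>.\<close>
  define a where "a = min (\<epsilon> / 2) (1 / 4)"
  define s where "s = (K - 1) * a"
  have a: "0 < a" "a < \<epsilon>" "a \<le> 1 / 4" using assms(3) by (auto simp: a_def)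
  have s: "a \<le> s" "s < 2 * a" "a + s = K * a" "2 * s = (2 * K - 2) * a"
    using assms a by (auto simp: s_def algebra_simps)
  obtain N where N: "compact N" "N \<subseteq> {0..s}" "s \<in> N" "negligible N" "N + N = {0..2 * s}"
  proof (rule scaled_null_set_with_interval_sumset)
    show "0 \<le> s" using a s by linarith
  qed
  define B M where "B = to_circle ` {0..a}" and "M = to_circle ` N"
  define A :: "(circle \<times> circle) set" where "A = B \<times> UNIV \<union> M \<times> {0}"

  have compact: "compact B" "compact M"
    using N(1) by (simp_all add: B_def M_def compact_to_circle_image)
  have "compact A"
    unfolding A_def
    by (intro compact_Un compact_Times compact compact_UNIV_circle) simp
  have B_ne: "B \<noteq> {}" using a by (simp add: B_def)

  have "{0..a} + ({0..a} \<union> N) = {0..a + s}"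
  proof
    show "{0..a} + ({0..a} \<union> N) \<subseteq> {0..a + s}"
    proof
      fix z assume "z \<in> {0..a} + ({0..a} \<union> N)"
      then obtain x y where "z = x + y" "x \<in> {0..a}" "y \<in> {0..a} \<union> N"
        by (rule set_plus_elim)
      moreover from this have "y \<in> {0..s}" using N(2) s by auto
      ultimately show "z \<in> {0..a + s}" by simp
    qed
    show "{0..a + s} \<subseteq> {0..a} + ({0..a} \<union> N)"
    proof
      fix z assume z: "z \<in> {0..a + s}"
      \<comment> \<open>Since \<open>s \<le> 2 a\<close>, halving reaches every \<open>z\<close> up to \<open>s\<close>, and the translate of \<open>[0, a]\<close> by the
        point \<open>s\<close> of \<open>N\<close> covers the rest.\<close>
      show "z \<in> {0..a} + ({0..a} \<union> N)"
      proof (cases "z \<le> s")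
        case True
        then have "z / 2 \<in> {0..a}" "z / 2 \<in> {0..a} \<union> N" using z s by auto
        from set_plus_intro[OF this] show ?thesis by simp
      next
        case False
        then have "z - s \<in> {0..a}" "s \<in> {0..a} \<union> N" using z N(3) by auto
        from set_plus_intro[OF this] show ?thesis by simp
      qed
    qed
  qed
  then have BBM: "B + (B \<union> M) = to_circle ` {0..a + s}"
    by (simp add: B_def M_def to_circle_image_plus flip: image_Un)
  have MM: "M + M = to_circle ` {0..2 * s}"
    by (simp add: M_def to_circle_image_plus N(5))

  have measure_A: "measure torus_haar A = a"
    using a by (simp add: A_def measure_torus_haar_strip_Un_horizontal compact
        B_def[symmetric]) (simp add: B_def measure_circle_haar_interval)
  have sum_A: "A + A = (B + (B \<union> M)) \<times> UNIV \<union> (M + M) \<times> {0}"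
    unfolding A_def by (rule strip_Un_horizontal_plus_self[OF B_ne])
  have measure_AA: "measure torus_haar (A + A) = K * a"
  proof -
    have "measure torus_haar (A + A) = measure circle_haar (to_circle ` {0..a + s})"
      unfolding sum_A BBM MM
      by (intro measure_torus_haar_strip_Un_horizontal compact_to_circle_image) auto
    also have "\<dots> = a + s"
      using a s by (intro measure_circle_haar_interval) auto
    finally show ?thesis using s by simp
  qed

  have fst_A: "fst ` A = B \<union> M"
    by (auto simp: A_def image_Un fst_image_times)
  have "s < 1" using a s(2) by linarith
  then have "N \<subseteq> {0..<1}" using N(2) by force
  then have "M \<in> null_sets circle_haar"
    unfolding M_def by (intro null_sets_circle_haar_image N)
  moreover have "B \<in> sets circle_haar"
    using compact by (simp add: sets_circle_haar borel_compact)
  ultimately have "measure circle_haar (fst ` A) = measure circle_haar B"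
    unfolding fst_A by (simp add: measure_Un_null_set)
  then have measure_fst_A: "measure circle_haar (fst ` A) = a"
    using a by (simp add: B_def measure_circle_haar_interval)
  have "fst ` A + fst ` A = (B + (B \<union> M)) \<union> (M + M)"
  proof -
    have "fst ` A + fst ` A = fst ` (A + A)"
    proof (intro equalityI subsetI)
      fix z assume "z \<in> fst ` A + fst ` A"
      then obtain u v where "z = fst (u + v)" "u \<in> A" "v \<in> A"
        by (elim set_plus_elim imageE) (simp only: fst_add)
      then show "z \<in> fst ` (A + A)" by (simp only: set_plus_intro imageI)
    next
      fix z assume "z \<in> fst ` (A + A)"
      then obtain u v where "z = fst u + fst v" "u \<in> A" "v \<in> A"
        by (elim imageE set_plus_elim) (simp only: fst_add)
      then show "z \<in> fst ` A + fst ` A" by (simp only: set_plus_intro imageI)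
    qed
    also have "\<dots> = (B + (B \<union> M)) \<union> (M + M)"
      unfolding sum_A by (auto simp: image_Un)
    finally show ?thesis .
  qed
  also have "\<dots> = to_circle ` {0..2 * s}"
    unfolding BBM MM using s by (auto simp flip: image_Un)
  finally have "fst ` A + fst ` A = to_circle ` {0..2 * s}" .
  moreover have "0 \<le> 2 * s" "2 * s < 1" using a s(1,2) by linarith+
  ultimately have measure_sum_fst: "measure circle_haar (fst ` A + fst ` A) = (2 * K - 2) * a"
    by (simp only: measure_circle_haar_interval s(4))

  show ?thesis
    using short_exact_coordinates \<open>compact A\<close> a
    by (intro exI[of _ "\<lambda>t. (0, t)"] exI[of _ fst] exI[of _ A])
      (simp add: measure_A measure_AA measure_fst_A measure_sum_fst algebra_simps)
qed

end
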